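(* Let $p_1,p_2,q_1,q_2$ be positive rational numbers such that $q_2>q_1$ and $p_2>p_1(q_1+q_2)/(q_2-q_1)$. Then there is a rational noncyclic convex quadrilateral $OABC$ whose sides $OA=a$, $AB=b$, $BC=c$, $OC=d$, diagonals $OB=e$, $AC=f$ and area $K$ are \begin{align*} a&=(p_1^2+p_2^2)^2(q_2^2-q_1^2)q_1q_2,\\ b&=p_1p_2(p_1^2+p_2^2)(q_2^4-q_1^4),\\ c&=2p_1p_2(p_1q_2+p_2q_1)(p_2q_2-p_1q_1)(q_1^2+q_2^2),\\ d&=(p_1q_2+p_2q_1)(p_2q_2-p_1q_1)(p_1q_1-p_1q_2-p_2q_1-p_2q_2)(p_1q_1+p_1q_2+p_2q_1-p_2q_2),\\ e&=(p_1^2+p_2^2)(p_2q_2-p_1q_1)(p_1q_2+p_2q_1)(q_2^2-q_1^2),\\ f&=p_1p_2(p_2^2-p_1^2)(q_1^2+q_2^2)^2,\\ K&=p_1p_2(p_2^2-p_1^2)(q_2^2-q_1^2)(p_1q_2+p_2q_1)(p_2q_2-p_1q_1)\\ &\quad\times(p_1q_1^2-p_1q_2^2-2p_2q_1q_2)(2p_1q_1q_2+p_2q_1^2-p_2q_2^2). \end{align*}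
   Context: A quadrilateral is called rational if the lengths of its four sides, the lengths of its two diagonals and its area are all rational numbers. A quadrilateral is cyclic if its four vertices lie on a circle, and noncyclic otherwise. $OABC$ denotes a quadrilateral with vertices in this cyclic order. *)

theory Defs
  imports "HOL-Analysis.Analysis"
begin

type_synonym point = "real^2"

definition quad_path :: "point \<Rightarrow> point \<Rightarrow> point \<Rightarrow> point \<Rightarrow> real \<Rightarrow> point" where
  "quad_path P A B C = linepath P A +++ linepath A B +++ linepath B C +++ linepath C P"

(* Throughout, the order of the four arguments is the cyclic order of the vertices, and
   a quadrilateral is a simple closed polygon with four genuine corners. *)
definition quadrilateral :: "point \<Rightarrow> point \<Rightarrow> point \<Rightarrow> point \<Rightarrow> bool" where
  "quadrilateral P A B C \<longleftrightarrow>
     simple_path (quad_path P A B C) \<and>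
     \<not> collinear {P, A, B} \<and> \<not> collinear {A, B, C} \<and>
     \<not> collinear {B, C, P} \<and> \<not> collinear {C, P, A}"

definition quad_region :: "point \<Rightarrow> point \<Rightarrow> point \<Rightarrow> point \<Rightarrow> point set" where
  "quad_region P A B C = inside (path_image (quad_path P A B C))"

definition quad_area :: "point \<Rightarrow> point \<Rightarrow> point \<Rightarrow> point \<Rightarrow> real" where
  "quad_area P A B C = measure lebesgue (quad_region P A B C)"

definition convex_quadrilateral :: "point \<Rightarrow> point \<Rightarrow> point \<Rightarrow> point \<Rightarrow> bool" where
  "convex_quadrilateral P A B C \<longleftrightarrow>
     quadrilateral P A B C \<and> convex (quad_region P A B C)"

definition rational_quadrilateral :: "point \<Rightarrow> point \<Rightarrow> point \<Rightarrow> point \<Rightarrow> bool" where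
  "rational_quadrilateral P A B C \<longleftrightarrow>
     quadrilateral P A B C \<and>
     dist P A \<in> \<rat> \<and> dist A B \<in> \<rat> \<and> dist B C \<in> \<rat> \<and> dist P C \<in> \<rat> \<and>
     dist P B \<in> \<rat> \<and> dist A C \<in> \<rat> \<and>
     quad_area P A B C \<in> \<rat>"

definition cyclic_quadrilateral :: "point \<Rightarrow> point \<Rightarrow> point \<Rightarrow> point \<Rightarrow> bool" where
  "cyclic_quadrilateral P A B C \<longleftrightarrow>
     quadrilateral P A B C \<and> (\<exists>z r. r > 0 \<and> {P, A, B, C} \<subseteq> sphere z r)"

definition noncyclic_quadrilateral :: "point \<Rightarrow> point \<Rightarrow> point \<Rightarrow> point \<Rightarrow> bool" where
  "noncyclic_quadrilateral P A B C \<longleftrightarrow>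
     quadrilateral P A B C \<and> \<not> cyclic_quadrilateral P A B C"

end

theory Submission
  imports Defs
begin

text \<open>
Encode the parameters as the squared complex numbers
\<open>(p2 + i p1)\<^sup>2 = w + 2ki\<close> and \<open>(q2 + i q1)\<^sup>2 = Q + 2mi\<close>, of moduli \<open>S = p1\<^sup>2 + p2\<^sup>2\<close> and
\<open>N = q1\<^sup>2 + q2\<^sup>2\<close>, and put \<open>L + 2Ti = (w + 2ki)(Q + 2mi)\<close>. The sought quadrilateral has its
diagonal \<open>OB\<close> along the angle bisector at \<open>O\<close> (denoted \<open>P\<close> below), and
the angles \<open>AOB\<close> and \<open>BOC\<close> are both the argument
of \<open>w + 2ki\<close>. The cosine and sine of that angle are \<open>w/S\<close> and \<open>2k/S\<close>, so rational lengths \<open>OA\<close>,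
\<open>OB\<close>, \<open>OC\<close> give rational coordinates and a rational area; their particular values make
\<open>AB\<close>, \<open>BC\<close> and \<open>AC\<close> rational as well, because \<open>S\<^sup>2 = w\<^sup>2 + 4k\<^sup>2\<close> and \<open>N\<^sup>2 = Q\<^sup>2 + 4m\<^sup>2\<close> turn the
sums of two squares that arise into perfect squares. The hypothesis on \<open>p2\<close> amounts to
\<open>L > 0\<close>, that is, to a positive length \<open>OC = T L\<close>.

Convexity at \<open>B\<close> and the failure of concyclicity both come down to the number \<open>k w N\<^sup>2\<close>
being positive: up to a positive factor it is the oriented area of \<open>ABC\<close>, and up to a negative
factor the defect in the condition that a circle through \<open>O\<close>, \<open>A\<close>, \<open>C\<close> passes through \<open>B\<close>. All this is
\<open>bisected_quadrilateral\<close>.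

It remains to connect the coordinates with the topological definitions of region and area. If the
four consecutive vertex triples of a closed polygonal path all turn left, the path
is the frontier of the compact convex set cut out by the four edge half-planes. Hence the region
inside the path is the interior of that set, and its area is the sum of the areas of the two
triangles on either side of a diagonal.
\<close>

section \<open>Oriented area and half-planes\<close>

text \<open>Twice the oriented area of the triangle \<open>U V z\<close>, positive when \<open>z\<close> lies to the left of the
directed line from \<open>U\<close> to \<open>V\<close>.\<close>

definition side :: "point \<Rightarrow> point \<Rightarrow> point \<Rightarrow> real" where
  "side U V z = (V$1 - U$1) * (z$2 - U$2) - (V$2 - U$2) * (z$1 - U$1)"

lemma side_rotate: "side U V W = side V W U"
  by (simp add: side_def algebra_simps)

lemma side_swap: "side V U z = - side U V z"
  by (simp add: side_def algebra_simps)

lemma side_self [simp]: "side U V U = 0" "side U V V = 0" "side U U z = 0"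
  by (simp_all add: side_def)

lemma side_affine: "side U V ((1 - t) *\<^sub>R X + t *\<^sub>R Y) = (1 - t) * side U V X + t * side U V Y"
  by (simp add: side_def algebra_simps)

lemma side_sum: "side U V z + side V W z + side W U z = side U V W"
  by (simp add: side_def algebra_simps)

lemma side_eq_inner:
  "side U V z = vector [U$2 - V$2, V$1 - U$1] \<bullet> z - vector [U$2 - V$2, V$1 - U$1] \<bullet> U"
  by (simp add: side_def inner_vec_def sum_2 algebra_simps)

lemma normal_nonzero: "(U::point) \<noteq> V \<Longrightarrow> vector [U$2 - V$2, V$1 - U$1] \<noteq> (0::point)"
  by (auto simp: vec_eq_iff forall_2)

lemma convex_halfplane: "convex {z. side U V z \<ge> 0}"
  using convex_halfspace_ge[of "vector [U$2 - V$2, V$1 - U$1] \<bullet> U" "vector [U$2 - V$2, V$1 - U$1]"]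
  by (simp add: side_eq_inner)

lemma interior_halfplane:
  "U \<noteq> V \<Longrightarrow> interior {z. side U V z \<ge> 0} = {z. side U V z > 0}"
  using interior_halfspace_ge[OF normal_nonzero, of U V "vector [U$2 - V$2, V$1 - U$1] \<bullet> U"]
  by (simp add: side_eq_inner)

lemma negligible_line: "U \<noteq> V \<Longrightarrow> negligible {z. side U V z = 0}"
  using negligible_hyperplane[OF disjI1[OF normal_nonzero], of U V "vector [U$2 - V$2, V$1 - U$1] \<bullet> U"]
  by (simp add: side_eq_inner)

lemma side_closed_segment:
  assumes "z \<in> closed_segment X Y"
  obtains t where "0 \<le> t" "t \<le> 1" "z = (1 - t) *\<^sub>R X + t *\<^sub>R Y"
    "\<And>U V. side U V z = (1 - t) * side U V X + t * side U V Y"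
  using assms side_affine unfolding closed_segment_def by blast

lemma side_nonzero_not_collinear:
  assumes "side U V W \<noteq> 0"
  shows "\<not> collinear {U, V, W}"
proof
  assume "collinear {U, V, W}"
  moreover have "U \<noteq> V"
    using assms by auto
  ultimately obtain t where W: "W = U + t *\<^sub>R (V - U)"
    using collinear_3_imp_in_affine_hull[of U V W]
    by (auto simp: affine_hull_2_alt)
  have "side U V W = 0"
    unfolding W side_def by (simp add: algebra_simps)
  with assms show False by simp
qed

text \<open>The oriented areas cut off by the three edges, divided by that of the whole triangle, are
the barycentric coordinates of a point; the triangle is where these are nonnegative.\<close>

lemma convex_hull_triangle_eq_halfplanes:
  assumes "side U V W > 0"
  shows "convex hull {U, V, W} = {z. side U V z \<ge> 0 \<and> side V W z \<ge> 0 \<and> side W U z \<ge> 0}"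
    (is "_ = ?R")
proof
  have "?R = {z. side U V z \<ge> 0} \<inter> {z. side V W z \<ge> 0} \<inter> {z. side W U z \<ge> 0}"
    by auto
  then have "convex ?R"
    by (simp add: convex_Int convex_halfplane)
  then show "convex hull {U, V, W} \<subseteq> ?R"
    using assms side_rotate[of U V W] side_rotate[of V W U] by (intro hull_minimal) auto
next
  show "?R \<subseteq> convex hull {U, V, W}"
  proof
    fix z assume z: "z \<in> ?R"
    let ?D = "side U V W"
    have "?D *\<^sub>R z = side V W z *\<^sub>R U + side W U z *\<^sub>R V + side U V z *\<^sub>R W"
      by (simp add: vec_eq_iff forall_2 side_def algebra_simps)
    then have "(1 / ?D) *\<^sub>R ?D *\<^sub>R z =
        (1 / ?D) *\<^sub>R (side V W z *\<^sub>R U + side W U z *\<^sub>R V + side U V z *\<^sub>R W)"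
      by simp
    then have "z = (side V W z / ?D) *\<^sub>R U + (side W U z / ?D) *\<^sub>R V + (side U V z / ?D) *\<^sub>R W"
      using assms by (simp add: scaleR_add_right)
    moreover have "side V W z / ?D + side W U z / ?D + side U V z / ?D = 1"
      using assms side_sum[of U V z W] by (simp add: field_simps)
    moreover have "side V W z / ?D \<ge> 0" "side W U z / ?D \<ge> 0" "side U V z / ?D \<ge> 0"
      using assms z by auto
    ultimately show "z \<in> convex hull {U, V, W}"
      unfolding convex_hull_3 by blast
  qed
qed

lemma measure_triangle: "measure lebesgue (convex hull {U, V, W}) = \<bar>side U V W\<bar> / 2"
proof -
  have "closed (convex hull {U, V, W})"
    by (intro compact_imp_closed finite_imp_compact_convex_hull) auto
  then have "measure lebesgue (convex hull {U, V, W}) = measure lborel (convex hull {U, V, W})"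
    by (intro measure_completion) simp
  also have "\<dots> = \<bar>side U V W\<bar> / 2"
    unfolding content_triangle side_def by (subst abs_minus_commute) (simp add: mult.commute)
  finally show ?thesis .
qed

text \<open>The line through \<open>U\<close> and \<open>V\<close> separates the two segments, which meet it only in \<open>U\<close> and in
\<open>V\<close>. This applies to opposite edges of a convex quadrilateral and a diagonal.\<close>

lemma disjoint_segments_across_line:
  assumes "side U V X * side U V Y < 0"
  shows "closed_segment U X \<inter> closed_segment V Y = {}"
proof -
  have False if "z \<in> closed_segment U X" "z \<in> closed_segment V Y" for z
  proof -
    from that(1) obtain s where s: "0 \<le> s" "z = (1 - s) *\<^sub>R U + s *\<^sub>R X"
      and 1: "side U V z = s * side U V X"
      by (elim side_closed_segment) auto
    from that(2) obtain t where t: "0 \<le> t" "z = (1 - t) *\<^sub>R V + t *\<^sub>R Y"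
      and 2: "side U V z = t * side U V Y"
      by (elim side_closed_segment) auto
    have "(side U V z)^2 = (s * t) * (side U V X * side U V Y)"
      using 1 2 by (metis mult.assoc mult.left_commute power2_eq_square)
    also have "\<dots> \<le> 0"
      using s t assms by (simp add: mult_nonneg_nonpos)
    finally have "side U V z = 0"
      by simp
    with 1 2 assms have "s = 0" "t = 0"
      by auto
    with s t assms show False
      by simp
  qed
  then show ?thesis by blast
qed

section \<open>Convex quadrilaterals given by four left turns\<close>

locale convex_ccw =
  fixes P A B C :: point
  assumes PAB: "side P A B > 0" and ABC: "side A B C > 0"
    and BCP: "side B C P > 0" and CPA: "side C P A > 0"
begin

definition polygon :: "point set" where
  "polygon = {z. side P A z \<ge> 0} \<inter> {z. side A B z \<ge> 0} \<inter> {z. side B C z \<ge> 0} \<inter> {z. side C P z \<ge> 0}"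

lemmas turns = PAB ABC BCP CPA
  PAB[unfolded side_rotate[of P A B]] ABC[unfolded side_rotate[of A B C]]
  BCP[unfolded side_rotate[of B C P]] CPA[unfolded side_rotate[of C P A]]
  PAB[folded side_rotate[of B P A]] ABC[folded side_rotate[of C A B]]
  BCP[folded side_rotate[of P B C]] CPA[folded side_rotate[of A C P]]

lemma distinct_vertices: "P \<noteq> A" "A \<noteq> B" "B \<noteq> C" "C \<noteq> P" "P \<noteq> B" "A \<noteq> C"
  using turns by auto

lemma convex_polygon: "convex polygon"
  unfolding polygon_def by (intro convex_Int convex_halfplane)

lemma vertices_in_polygon: "P \<in> polygon" "A \<in> polygon" "B \<in> polygon" "C \<in> polygon"
  using turns by (auto simp: polygon_def)

text \<open>A point satisfying the four edge inequalities satisfies the three inequalities of whichever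
triangle lies on its own side of the diagonal \<open>P B\<close>.\<close>

lemma polygon_split: "polygon = convex hull {P, A, B} \<union> convex hull {P, B, C}"
proof
  show "polygon \<subseteq> convex hull {P, A, B} \<union> convex hull {P, B, C}"
  proof
    fix z assume z: "z \<in> polygon"
    show "z \<in> convex hull {P, A, B} \<union> convex hull {P, B, C}"
    proof (cases "side P B z \<ge> 0")
      case True
      with z show ?thesis
        using turns by (auto simp: convex_hull_triangle_eq_halfplanes polygon_def)
    next
      case False
      with z show ?thesis
        using turns side_swap[of P B z]
        by (auto simp: convex_hull_triangle_eq_halfplanes polygon_def)
    qed
  qed
  show "convex hull {P, A, B} \<union> convex hull {P, B, C} \<subseteq> polygon"
    using vertices_in_polygon convex_polygon by (intro Un_least hull_minimal) auto
qed

lemma compact_polygon: "compact polygon"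
  unfolding polygon_split by (intro compact_Un finite_imp_compact_convex_hull) auto

lemma interior_polygon:
  "interior polygon =
     {z. side P A z > 0} \<inter> {z. side A B z > 0} \<inter> {z. side B C z > 0} \<inter> {z. side C P z > 0}"
  unfolding polygon_def by (simp add: interior_halfplane distinct_vertices)

lemma path_image_quad_path:
  "path_image (quad_path P A B C) =
     closed_segment P A \<union> closed_segment A B \<union> closed_segment B C \<union> closed_segment C P"
  by (auto simp: quad_path_def path_image_join)

text \<open>The splitting into two triangles confines the frontier to the four edges and the diagonal
\<open>P B\<close>; relative interior points of the diagonal satisfy all four inequalities strictly and drop
out.\<close>

lemma frontier_polygon: "frontier polygon = path_image (quad_path P A B C)"
proof
  have frontier: "frontier polygon = polygon - interior polygon"
    using compact_polygon by (simp add: frontier_def compact_imp_closed)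
  show "path_image (quad_path P A B C) \<subseteq> frontier polygon"
  proof
    fix z assume "z \<in> path_image (quad_path P A B C)"
    then consider "z \<in> closed_segment P A" | "z \<in> closed_segment A B"
      | "z \<in> closed_segment B C" | "z \<in> closed_segment C P"
      unfolding path_image_quad_path by blast
    then have "z \<in> polygon \<and> z \<notin> interior polygon"
      using vertices_in_polygon
      by cases (auto simp: interior_polygon convexD_alt[OF convex_polygon]
          elim!: side_closed_segment)
    then show "z \<in> frontier polygon"
      unfolding frontier by simp
  qed
  show "frontier polygon \<subseteq> path_image (quad_path P A B C)"
  proof
    fix z assume z: "z \<in> frontier polygon"
    have "frontier polygon \<subseteq> path_image (quad_path P A B C) \<union> closed_segment P B"
      unfolding polygon_split path_image_quad_path
      using frontier_Un_subset[of "convex hull {P, A, B}" "convex hull {P, B, C}"]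
      by (auto simp: frontier_of_triangle closed_segment_commute)
    with z consider "z \<in> path_image (quad_path P A B C)" | "z \<in> closed_segment P B"
      by blast
    then show "z \<in> path_image (quad_path P A B C)"
    proof cases
      case 2
      then obtain t where t: "0 \<le> t" "t \<le> 1" "z = (1 - t) *\<^sub>R P + t *\<^sub>R B"
        and side: "\<And>U V. side U V z = (1 - t) * side U V P + t * side U V B"
        by (rule side_closed_segment) (rule that)
      have "\<not> (0 < t \<and> t < 1)"
      proof
        assume "0 < t \<and> t < 1"
        then have "z \<in> interior polygon"
          using turns by (auto simp: interior_polygon side)
        with z show False by (simp add: frontier)
      qed
      with t have "z = P \<or> z = B"
        by (cases "t = 0"; cases "t = 1") auto
      then show ?thesis
        by (auto simp: path_image_quad_path)
    qed
  qed
qed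

lemma quad_region_eq: "quad_region P A B C = interior polygon"
  unfolding quad_region_def frontier_polygon[symmetric]
  by (intro inside_frontier_eq_interior convex_polygon compact_imp_bounded compact_polygon)

lemma simple_path_quad_path: "simple_path (quad_path P A B C)"
proof -
  have corner: "closed_segment U V \<inter> closed_segment V W = {V}" if "side U V W > 0" for U V W
    using that side_nonzero_not_collinear[of U V W] by (intro Int_closed_segment) auto
  have opposite: "closed_segment P A \<inter> closed_segment B C = {}"
      "closed_segment A B \<inter> closed_segment C P = {}"
    using disjoint_segments_across_line[of P B A C] disjoint_segments_across_line[of B P A C]
      turns side_swap[of P B A] side_swap[of B P C]
    by (simp_all add: closed_segment_commute mult_less_0_iff)
  have "arc (linepath A B +++ linepath B C +++ linepath C P)"
    using distinct_vertices corner[of A B C] corner[of B C P] turns opposite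
    by (intro arc_join) (auto simp: path_image_join)
  then show ?thesis
    unfolding quad_path_def
    using distinct_vertices corner[of P A B] corner[of C P A] turns opposite
    by (intro simple_path_join_loop) (auto simp: path_image_join)
qed

lemma quadrilateral: "quadrilateral P A B C"
  unfolding quadrilateral_def
  using simple_path_quad_path turns by (auto intro!: side_nonzero_not_collinear)

lemma convex_quadrilateral: "convex_quadrilateral P A B C"
  unfolding convex_quadrilateral_def quad_region_eq
  using quadrilateral convex_polygon by simp

lemma quad_area_eq: "quad_area P A B C = (side P A B + side B C P) / 2"
proof -
  let ?T1 = "convex hull {P, A, B}" and ?T2 = "convex hull {P, B, C}"
  have meas: "?T1 \<in> lmeasurable" "?T2 \<in> lmeasurable"
    by (auto intro!: lmeasurable_compact finite_imp_compact_convex_hull)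
  have "side P B z = 0" if "z \<in> ?T1 \<inter> ?T2" for z
    using that turns side_swap[of P B z] by (auto simp: convex_hull_triangle_eq_halfplanes)
  then have "negligible (?T1 \<inter> ?T2)"
    using negligible_line[of P B] distinct_vertices by (auto intro: negligible_subset)
  then have "measure lebesgue (?T1 \<inter> ?T2) = 0"
    by (rule negligible_imp_measure0)
  then have "measure lebesgue polygon = measure lebesgue ?T1 + measure lebesgue ?T2"
    unfolding polygon_split using meas by (simp add: measure_Un3)
  also have "\<dots> = (side P A B + side B C P) / 2"
    using turns side_rotate[of P B C] by (simp add: measure_triangle add_divide_distrib)
  also have "measure lebesgue polygon = measure lebesgue (interior polygon)"
    by (intro measure_interior[symmetric] compact_imp_bounded compact_polygon
        negligible_convex_frontier convex_polygon)
  finally show ?thesis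
    by (simp add: quad_area_def quad_region_eq)
qed

end

section \<open>The construction\<close>

lemma dist_point_square: "dist X Y ^ 2 = (X$1 - Y$1)^2 + (X$2 - Y$2)^2" for X Y :: point
  by (simp add: dist_vec_def L2_set_def sum_2 dist_real_def)

lemma dist_point_eq:
  fixes X Y :: point
  assumes "r \<ge> 0" "(X$1 - Y$1)^2 + (X$2 - Y$2)^2 = r^2"
  shows "dist X Y = r"
  using assms by - (rule power2_eq_imp_eq, simp_all add: dist_point_square)

text \<open>The vertex \<open>P\<close> is the origin and \<open>B\<close> lies on the positive first axis, which bisects the
angle \<open>A P C\<close>; \<open>\<alpha>\<close> and \<open>\<gamma>\<close> are the factors by which \<open>(w, -2k)\<close> and \<open>(w, 2k)\<close>, both of norm
\<open>S\<close>, are stretched to \<open>A\<close> and \<open>C\<close>. Since \<open>\<gamma>\<close> has denominator \<open>S\<close>, identities involving it are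
multiplied by \<open>S\<close> first, which reduces them to polynomial identities in \<open>k\<close>, \<open>m\<close>, \<open>w\<close>, \<open>Q\<close>.\<close>

lemma bisected_quadrilateral:
  fixes k m w Q S N L T :: real
  assumes pos: "k > 0" "m > 0" "w > 0" "Q > 0" "S > 0" "N > 0" "L > 0"
    and S: "S^2 = w^2 + 4 * k^2" and N: "N^2 = Q^2 + 4 * m^2"
    and L: "L = w * Q - 4 * k * m" and T: "T = m * w + k * Q"
  obtains P A B C :: point where
    "convex_quadrilateral P A B C" "noncyclic_quadrilateral P A B C"
    "dist P A = S^2 * Q * m" "dist A B = k * S * Q * N" "dist B C = 2 * k * T * N"
    "dist P C = T * L" "dist P B = S * T * Q" "dist A C = k * w * N^2"
    "quad_area P A B C = k * w * Q * T * (2 * m * w * Q + k * (Q^2 - 4 * m^2))"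
proof -
  define \<alpha> \<gamma> e where "\<alpha> = S * Q * m" and "\<gamma> = T * L / S" and "e = S * T * Q"
  define P A B C :: point where "P = 0" and "A = vector [\<alpha> * w, - 2 * \<alpha> * k]"
    and "B = vector [e, 0]" and "C = vector [\<gamma> * w, 2 * \<gamma> * k]"
  note points = P_def A_def B_def C_def
  have T0: "T > 0"
    using pos by (simp add: T add_pos_pos)
  have pos': "\<alpha> > 0" "\<gamma> > 0" "e > 0"
    using pos T0 by (auto simp: \<alpha>_def \<gamma>_def e_def)
  have S\<gamma>: "S * \<gamma> = T * L"
    using pos by (simp add: \<gamma>_def)
  have S\<alpha>: "S * \<alpha> = (w^2 + 4 * k^2) * Q * m"
    unfolding S[symmetric] \<alpha>_def by algebra
  \<comment> \<open>The axis meets the line \<open>A C\<close> at abscissa \<open>2 \<alpha> \<gamma> w / (\<alpha> + \<gamma>)\<close>, so this places \<open>B\<close>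
      strictly beyond that line as seen from \<open>P\<close>.\<close>
  have crossing: "e * (\<alpha> + \<gamma>) - 2 * \<alpha> * \<gamma> * w = T * Q * k * w * N^2"
  proof -
    have "e * (\<alpha> + \<gamma>) - 2 * \<alpha> * \<gamma> * w = T * Q * (S * \<alpha> + S * \<gamma>) - 2 * Q * m * w * (S * \<gamma>)"
      by (simp add: e_def \<alpha>_def algebra_simps)
    also have "\<dots> = T * Q * (k * w * N^2)"
      unfolding S\<alpha> S\<gamma> N T L by algebra
    finally show ?thesis
      by (simp add: mult.assoc)
  qed
  interpret convex_ccw P A B C
  proof
    show "side P A B > 0" "side B C P > 0"
      using pos pos' by (simp_all add: side_def points)
    have "side C P A = 4 * \<alpha> * \<gamma> * w * k"
      by (simp add: side_def points algebra_simps)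
    then show "side C P A > 0"
      using pos pos' by simp
    have "side A B C = 2 * k * (e * (\<alpha> + \<gamma>) - 2 * \<alpha> * \<gamma> * w)"
      by (simp add: side_def points algebra_simps)
    then show "side A B C > 0"
      using pos T0 by (simp add: crossing)
  qed
  have "\<not> cyclic_quadrilateral P A B C"
  proof
    assume "cyclic_quadrilateral P A B C"
    then obtain z r where "dist z P = r" "dist z A = r" "dist z B = r" "dist z C = r"
      by (auto simp: cyclic_quadrilateral_def sphere_def)
    then have "dist z A ^2 = dist z P ^2" "dist z B ^2 = dist z P ^2" "dist z C ^2 = dist z P ^2"
      by simp_all
    \<comment> \<open>As \<open>P\<close> is the origin, a point \<open>X\<close> of the circle with centre \<open>z\<close> through \<open>P\<close> satisfies
        \<open>X \<bullet> X = 2 (z \<bullet> X)\<close>; adding the equations for \<open>A\<close> and \<open>C\<close> eliminates the second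
        coordinate of \<open>z\<close>, and the equation for \<open>B\<close> gives the first.\<close>
    then have
      "\<alpha> * (\<alpha> * (w^2 + 4 * k^2)) = \<alpha> * (2 * (w * z$1 - 2 * k * z$2))"
      "e * e = e * (2 * z$1)"
      "\<gamma> * (\<gamma> * (w^2 + 4 * k^2)) = \<gamma> * (2 * (w * z$1 + 2 * k * z$2))"
      unfolding dist_point_square points by (simp_all add: power2_eq_square algebra_simps)
    moreover have "\<alpha> \<noteq> 0" "e \<noteq> 0" "\<gamma> \<noteq> 0"
      using pos' by simp_all
    ultimately have 1: "\<alpha> * S^2 = 2 * (w * z$1 - 2 * k * z$2)"
      and 2: "e = 2 * z$1" and 3: "\<gamma> * S^2 = 2 * (w * z$1 + 2 * k * z$2)"
      unfolding S by (simp_all only: mult_cancel_left simp_thms)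
    have "S * (S * (\<alpha> + \<gamma>)) = \<alpha> * S^2 + \<gamma> * S^2"
      by algebra
    also have "\<dots> = 2 * w * e"
      unfolding 1 2 3 by algebra
    finally have "S * (S * (\<alpha> + \<gamma>) - 2 * w * T * Q) = 0"
      unfolding e_def by algebra
    moreover have "S * (\<alpha> + \<gamma>) - 2 * w * T * Q = - (k * w * N^2)"
      unfolding distrib_left S\<alpha> S\<gamma> N T L by algebra
    ultimately show False
      using pos by simp
  qed
  then have "noncyclic_quadrilateral P A B C"
    using quadrilateral by (simp add: noncyclic_quadrilateral_def)
  moreover have "dist P A = S^2 * Q * m"
  proof (rule dist_point_eq)
    have "(P$1 - A$1)^2 + (P$2 - A$2)^2 = \<alpha>^2 * (w^2 + 4 * k^2)"
      by (simp add: points power2_eq_square algebra_simps)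
    then show "(P$1 - A$1)^2 + (P$2 - A$2)^2 = (S^2 * Q * m)^2"
      unfolding S[symmetric] \<alpha>_def by algebra
  qed (use pos in simp)
  moreover have "dist A B = k * S * Q * N"
  proof (rule dist_point_eq)
    have "(A$1 - B$1)^2 + (A$2 - B$2)^2 = (S * Q * k)^2 * (Q^2 + 4 * m^2)"
      by (simp add: points \<alpha>_def e_def T power2_eq_square algebra_simps)
    then show "(A$1 - B$1)^2 + (A$2 - B$2)^2 = (k * S * Q * N)^2"
      unfolding N[symmetric] by algebra
  qed (use pos in simp)
  moreover have "dist B C = 2 * k * T * N"
  proof (rule dist_point_eq)
    have "S^2 * ((B$1 - C$1)^2 + (B$2 - C$2)^2) =
        (S^2 * T * Q - S * \<gamma> * w)^2 + 4 * (S * \<gamma> * k)^2"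
      by (simp add: points e_def power2_eq_square algebra_simps)
    also have "\<dots> = S^2 * (2 * k * T * N)^2"
      unfolding power_mult_distrib S\<gamma> S N unfolding T L by algebra
    finally show "(B$1 - C$1)^2 + (B$2 - C$2)^2 = (2 * k * T * N)^2"
      using pos by simp
  qed (use pos T0 in simp)
  moreover have "dist P C = T * L"
  proof (rule dist_point_eq)
    have "(P$1 - C$1)^2 + (P$2 - C$2)^2 = \<gamma>^2 * (w^2 + 4 * k^2)"
      by (simp add: points power2_eq_square algebra_simps)
    then show "(P$1 - C$1)^2 + (P$2 - C$2)^2 = (T * L)^2"
      unfolding S[symmetric] S\<gamma>[symmetric] by algebra
  qed (use pos T0 in simp)
  moreover have "dist P B = S * T * Q"
    using pos' by (intro dist_point_eq) (simp_all add: points e_def)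
  moreover have "dist A C = k * w * N^2"
  proof (rule dist_point_eq)
    have "S^2 * ((A$1 - C$1)^2 + (A$2 - C$2)^2) =
        (S * \<alpha> * w - S * \<gamma> * w)^2 + 4 * (S * \<alpha> * k + S * \<gamma> * k)^2"
      by (simp add: points power2_eq_square algebra_simps)
    also have "\<dots> = S^2 * (k * w * N^2)^2"
      unfolding S\<gamma> S\<alpha> S N unfolding T L by algebra
    finally show "(A$1 - C$1)^2 + (A$2 - C$2)^2 = (k * w * N^2)^2"
      using pos by simp
  qed (use pos in simp)
  moreover have "quad_area P A B C = k * w * Q * T * (2 * m * w * Q + k * (Q^2 - 4 * m^2))"
  proof -
    have "quad_area P A B C = k * T * Q * (S * \<alpha> + S * \<gamma>)"
      unfolding quad_area_eq by (simp add: side_def points e_def algebra_simps)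
    also have "\<dots> = k * w * Q * T * (2 * m * w * Q + k * (Q^2 - 4 * m^2))"
      unfolding S\<gamma> S\<alpha> T L by algebra
    finally show ?thesis .
  qed
  ultimately show ?thesis
    using convex_quadrilateral that by blast
qed

theorem mainTheorem5:
  fixes p1 p2 q1 q2 :: real
  assumes "p1 \<in> \<rat>" "p2 \<in> \<rat>" "q1 \<in> \<rat>" "q2 \<in> \<rat>"
    and "p1 > 0" "p2 > 0" "q1 > 0" "q2 > 0"
    and "q2 > q1"
    and "p2 > p1 * (q1 + q2) / (q2 - q1)"
  shows "\<exists>P A B C :: real^2.
    rational_quadrilateral P A B C \<and>
    noncyclic_quadrilateral P A B C \<and>
    convex_quadrilateral P A B C \<and>
    dist P A = (p1^2 + p2^2)^2 * (q2^2 - q1^2) * q1 * q2 \<and>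
    dist A B = p1 * p2 * (p1^2 + p2^2) * (q2^4 - q1^4) \<and>
    dist B C = 2 * p1 * p2 * (p1*q2 + p2*q1) * (p2*q2 - p1*q1) * (q1^2 + q2^2) \<and>
    dist P C = (p1*q2 + p2*q1) * (p2*q2 - p1*q1) * (p1*q1 - p1*q2 - p2*q1 - p2*q2)
                * (p1*q1 + p1*q2 + p2*q1 - p2*q2) \<and>
    dist P B = (p1^2 + p2^2) * (p2*q2 - p1*q1) * (p1*q2 + p2*q1) * (q2^2 - q1^2) \<and>
    dist A C = p1 * p2 * (p2^2 - p1^2) * (q1^2 + q2^2)^2 \<and>
    quad_area P A B C =
      p1 * p2 * (p2^2 - p1^2) * (q2^2 - q1^2) * (p1*q2 + p2*q1) * (p2*q2 - p1*q1)
        * (p1*q1^2 - p1*q2^2 - 2*p2*q1*q2) * (2*p1*q1*q2 + p2*q1^2 - p2*q2^2)"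
proof -
  note pos = \<open>p1 > 0\<close> \<open>p2 > 0\<close> \<open>q1 > 0\<close> \<open>q2 > 0\<close>
  note rat = \<open>p1 \<in> \<rat>\<close> \<open>p2 \<in> \<rat>\<close> \<open>q1 \<in> \<rat>\<close> \<open>q2 \<in> \<rat>\<close>
  have q: "q2 - q1 > 0"
    using \<open>q2 > q1\<close> by simp
  \<comment> \<open>This is the sign condition on the factor of \<open>L\<close> that is not negative automatically.\<close>
  have slope: "p1 * (q1 + q2) < p2 * (q2 - q1)"
    using assms(10) q by (simp add: pos_divide_less_eq)
  have "p1 * (q2 - q1) \<le> p1 * (q1 + q2)"
    using pos by simp
  with slope have "p1 * (q2 - q1) < p2 * (q2 - q1)"
    by linarith
  then have "p1 < p2"
    using q by simp
  define k m w Q S N L T where "k = p1 * p2" and "m = q1 * q2" and "w = p2^2 - p1^2"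
    and "Q = q2^2 - q1^2" and "S = p1^2 + p2^2" and "N = q1^2 + q2^2"
    and "L = w * Q - 4 * k * m" and "T = m * w + k * Q"
  note defs = k_def m_def w_def Q_def S_def N_def
  have L_factors: "L = (p1*q1 - p1*q2 - p2*q1 - p2*q2) * (p1*q1 + p1*q2 + p2*q1 - p2*q2)"
    unfolding L_def defs by algebra
  have T_factors: "T = (p1*q2 + p2*q1) * (p2*q2 - p1*q1)"
    unfolding T_def defs by algebra
  have K_factors: "2 * m * w * Q + k * (Q^2 - 4 * m^2) =
      (p1*q1^2 - p1*q2^2 - 2*p2*q1*q2) * (2*p1*q1*q2 + p2*q1^2 - p2*q2^2)"
    unfolding defs by algebra
  have "L > 0"
  proof -
    have "p1*q1 + p1*q2 + p2*q1 - p2*q2 < 0"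
      using slope by (simp add: algebra_simps)
    moreover have "p1*q1 - p1*q2 - p2*q1 - p2*q2 < 0"
    proof -
      have "p1 * q1 < p1 * q2" "p2 * q1 > 0" "p2 * q2 > 0"
        using pos \<open>q2 > q1\<close> by simp_all
      then show ?thesis by linarith
    qed
    ultimately show ?thesis
      unfolding L_factors by (rule mult_neg_neg[rotated])
  qed
  moreover have "k > 0" "m > 0" "w > 0" "Q > 0" "S > 0" "N > 0"
    using pos \<open>p1 < p2\<close> \<open>q2 > q1\<close> by (simp_all add: defs power_strict_mono add_pos_pos)
  moreover have "S^2 = w^2 + 4 * k^2" "N^2 = Q^2 + 4 * m^2"
    unfolding defs by algebra+
  ultimately obtain P A B C :: point where quad:
    "convex_quadrilateral P A B C" "noncyclic_quadrilateral P A B C"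
    and eqs: "dist P A = S^2 * Q * m" "dist A B = k * S * Q * N" "dist B C = 2 * k * T * N"
    "dist P C = T * L" "dist P B = S * T * Q" "dist A C = k * w * N^2"
    "quad_area P A B C = k * w * Q * T * (2 * m * w * Q + k * (Q^2 - 4 * m^2))"
    using bisected_quadrilateral[of k m w Q S N L T] L_def T_def by metis
  have "rational_quadrilateral P A B C"
    unfolding rational_quadrilateral_def eqs
    using quad rat by (simp add: convex_quadrilateral_def L_def T_def defs)
  moreover have "q2^4 - q1^4 = Q * N"
    unfolding defs by algebra
  ultimately show ?thesis
    using quad
    by (intro exI[of _ P] exI[of _ A] exI[of _ B] exI[of _ C])
      (simp add: eqs K_factors, simp add: L_factors T_factors, simp add: defs mult_ac)
qed

end
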